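(* Let $H\in C^2(\mathbb{R}^4)$. If $D^2_{pp}H\succ0$, i.e. the matrix $(\partial^2H/\partial p_i\partial p_j)_{i,j=1,2}$ is positive definite everywhere, then $\partial^2_{p_1p_1}H>0$, and hence both (U) and (N) hold, the latter with positive sign. The condition $D^2_{pp}H\succ0$ does not imply (C), and does not imply (R). Ordinary strict convexity of the fibre functions $h_b$ implies (U) but does not imply (N).
   Context: Coordinates on $\mathbb{R}^4$ are $(q_1,q_2,p_1,p_2)$. For $b=(q_2,p_2)\in\mathbb{R}^2$ the fibre function is $h_b(p_1)=H(0,q_2,p_1,p_2)$, and $\mathcal{E}(b)=\inf_{p_1\in\mathbb{R}}h_b(p_1)$. Strict convexity of $h_b$ means $h_b(tp+(1-t)q)<t\,h_b(p)+(1-t)h_b(q)$ for all $p\ne q$ and $0<t<1$. (C): $h_b(p_1)\to+\infty$ as $|p_1|\to\infty$, locally uniformly in $b$. (U): for every $b$, $h_b\in C^1$ and there is a unique $m(b)\in\mathbb{R}$ with $h_b'<0$ on $(-\infty,m(b))$ and $h_b'>0$ on $(m(b),\infty)$. (N): $\partial^2_{p_1p_1}H\neq0$ at the fibrewise critical point under consideration (a point of $\{q_1=0\}$ where $\partial_{p_1}H=0$). (R) at an energy $E\in\mathbb{R}$: $E$ is a regular value of $\mathcal{E}\colon\mathbb{R}^2\to\mathbb{R}$.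
   Formalization: Both implications into (U), from D²_pp H ≻ 0 and from strict convexity of the h_b, are proved under the added hypothesis (C); without it they fail, e.g. for H = exp(p₁) + p₂², whose fibre functions have no critical point. *)

theory Defs
  imports "HOL-Analysis.Analysis"
begin

(* Points of R^4 are x :: real^4 with x$1 = q_1, x$2 = q_2, x$3 = p_1, x$4 = p_2;
   points of R^2 are b :: real^2 with b$1 = q_2, b$2 = p_2. *)

definition partial :: "'n \<Rightarrow> (real^'n \<Rightarrow> real) \<Rightarrow> real^'n \<Rightarrow> real" where
  "partial i f x = deriv (\<lambda>t. f (x + t *\<^sub>R axis i 1)) 0"

(* Existence and continuity of the partial derivatives; this already forces continuity (and total
   differentiability) of f itself. *)
definition C1_fun :: "(real^'n \<Rightarrow> real) \<Rightarrow> bool" where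
  "C1_fun f \<longleftrightarrow>
     (\<forall>i x. (\<lambda>t. f (x + t *\<^sub>R axis i 1)) differentiable (at 0)) \<and>
     (\<forall>i. continuous_on UNIV (partial i f))"

definition C2_fun :: "(real^'n \<Rightarrow> real) \<Rightarrow> bool" where
  "C2_fun f \<longleftrightarrow> C1_fun f \<and> (\<forall>i. C1_fun (partial i f))"

definition pidx :: "2 \<Rightarrow> 4" where
  "pidx i = (if i = 1 then 3 else 4)"

definition Dpp :: "(real^4 \<Rightarrow> real) \<Rightarrow> real^4 \<Rightarrow> real^2^2" where
  "Dpp H x = (\<chi> i j. partial (pidx i) (partial (pidx j) H) x)"

(* Symmetry is not demanded: the matrices Dpp H x are symmetric by Schwarz's theorem
   whenever H is C^2. *)
definition positive_definite :: "real^'n^'n \<Rightarrow> bool" where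
  "positive_definite A \<longleftrightarrow> (\<forall>v. v \<noteq> 0 \<longrightarrow> v \<bullet> (A *v v) > 0)"

definition fibre :: "(real^4 \<Rightarrow> real) \<Rightarrow> real^2 \<Rightarrow> real \<Rightarrow> real" where
  "fibre H b p = H (vector [0, b $ 1, p, b $ 2])"

(* A real infimum, hence only meaningful when every fibre function is bounded below;
   this is guaranteed for continuous H satisfying cond_C. *)
definition fibre_inf :: "(real^4 \<Rightarrow> real) \<Rightarrow> real^2 \<Rightarrow> real" where
  "fibre_inf H b = (INF p. fibre H b p)"

definition strictly_convex :: "(real \<Rightarrow> real) \<Rightarrow> bool" where
  "strictly_convex h \<longleftrightarrow>
     (\<forall>p q t. p \<noteq> q \<and> 0 < t \<and> t < 1 \<longrightarrow> h (t * p + (1 - t) * q) < t * h p + (1 - t) * h q)"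

definition cond_C :: "(real^4 \<Rightarrow> real) \<Rightarrow> bool" where
  "cond_C H \<longleftrightarrow>
     (\<forall>b0. \<exists>V. open V \<and> b0 \<in> V \<and> (\<forall>M. \<exists>R. \<forall>b\<in>V. \<forall>p. \<bar>p\<bar> \<ge> R \<longrightarrow> fibre H b p \<ge> M))"

definition cond_U :: "(real^4 \<Rightarrow> real) \<Rightarrow> bool" where
  "cond_U H \<longleftrightarrow>
     (\<forall>b. fibre H b C1_differentiable_on UNIV \<and>
          (\<exists>!m. (\<forall>p<m. deriv (fibre H b) p < 0) \<and> (\<forall>p>m. deriv (fibre H b) p > 0)))"

definition fibre_critical :: "(real^4 \<Rightarrow> real) \<Rightarrow> real^4 \<Rightarrow> bool" where
  "fibre_critical H x \<longleftrightarrow> x $ 1 = 0 \<and> partial 3 H x = 0"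

definition cond_N :: "(real^4 \<Rightarrow> real) \<Rightarrow> bool" where
  "cond_N H \<longleftrightarrow> (\<forall>x. fibre_critical H x \<longrightarrow> partial 3 (partial 3 H) x \<noteq> 0)"

definition cond_N_pos :: "(real^4 \<Rightarrow> real) \<Rightarrow> bool" where
  "cond_N_pos H \<longleftrightarrow> (\<forall>x. fibre_critical H x \<longrightarrow> partial 3 (partial 3 H) x > 0)"

definition regular_value :: "(real^2 \<Rightarrow> real) \<Rightarrow> real \<Rightarrow> bool" where
  "regular_value f c \<longleftrightarrow> (\<forall>b. f b = c \<longrightarrow> (\<exists>D. (f has_derivative D) (at b) \<and> surj D))"

definition cond_R :: "(real^4 \<Rightarrow> real) \<Rightarrow> real \<Rightarrow> bool" where
  "cond_R H E \<longleftrightarrow> regular_value (fibre_inf H) E"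

lemma partial_of_derivative:
  assumes "(f has_derivative f') (at x)"
  shows "(\<lambda>t. f (x + t *\<^sub>R axis i 1)) differentiable (at 0)" "partial i f x = f' (axis i 1)"
proof -
  have "((\<lambda>t. f (x + t *\<^sub>R axis i 1)) has_derivative (\<lambda>t. f' (t *\<^sub>R axis i 1))) (at 0)"
    by (rule has_derivative_compose[of "\<lambda>t. x + t *\<^sub>R axis i 1" "\<lambda>t. t *\<^sub>R axis i 1" 0 UNIV f f'])
       (auto intro!: derivative_eq_intros assms)
  moreover have "f' (t *\<^sub>R axis i 1) = t * f' (axis i 1)" for t
    using assms has_derivative_linear linear_cmul by fastforce
  ultimately have D: "((\<lambda>t. f (x + t *\<^sub>R axis i 1)) has_field_derivative f' (axis i 1)) (at 0)"
    unfolding has_field_derivative_def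
    by (simp add: mult.commute[of "f' (axis i 1)"] ext[of "(*) (f' (axis i 1))" "\<lambda>t. t * f' (axis i 1)"])
  show "(\<lambda>t. f (x + t *\<^sub>R axis i 1)) differentiable (at 0)"
    using D by (meson differentiable_def has_field_derivative_def)
  show "partial i f x = f' (axis i 1)" unfolding partial_def using D by (rule DERIV_imp_deriv)
qed

(* Positive definiteness of Dpp H, or strict convexity of all fibre functions, does not by itself
   give cond_U: exp p_1 + p_2^2 has no fibrewise critical points.  The missing ingredient is
   attainment of the fibrewise infimum, which cond_C supplies. *)
definition expH :: "real^4 \<Rightarrow> real" where
  "expH x = exp (x$3) + (x$4)^2"

definition expd where
  "expd = (\<lambda>(i::4) (x::real^4). exp (x$3) * (axis i (1::real)) $ 3 + 2 * x$4 * (axis i 1) $ 4)"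

definition expdd where
  "expdd = (\<lambda>(i::4) (j::4) (x::real^4). (exp (x$3) * (axis i (1::real)) $ 3) * (axis j (1::real)) $ 3 + 2 * (axis i 1) $ 4 * (axis j 1) $ 4)"

lemma expH_deriv: "(expH has_derivative (\<lambda>v. exp (x$3) * v$3 + 2 * x$4 * v$4)) (at x)"
  unfolding expH_def[abs_def]
  by (auto intro!: derivative_eq_intros bounded_linear_imp_has_derivative bounded_linear_vec_nth)

lemma partial_expH: "partial i expH = expd i"
  by (rule ext) (simp add: partial_of_derivative(2)[OF expH_deriv] expd_def)

lemma expd_deriv: "(expd i has_derivative (\<lambda>v. exp (x$3) * axis i (1::real) $ 3 * v$3 + 2 * v$4 * axis i 1 $ 4)) (at x)"
  unfolding expd_def
  by (auto intro!: derivative_eq_intros bounded_linear_imp_has_derivative bounded_linear_vec_nth)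

lemma partial_expd: "partial j (expd i) = expdd i j"
  by (rule ext) (simp add: partial_of_derivative(2)[OF expd_deriv] expdd_def)

lemma C2_expH: "C2_fun expH"
  unfolding C2_fun_def C1_fun_def partial_expH partial_expd
  using partial_of_derivative(1)[OF expH_deriv] partial_of_derivative(1)[OF expd_deriv]
  by (auto simp: expd_def expdd_def intro!: continuous_intros)

lemma positive_definite_Dpp_expH: "positive_definite (Dpp expH x)"
proof -
  have "v \<bullet> (Dpp expH x *v v) = exp (x$3) * (v$1)^2 + 2 * (v$2)^2" for v
    by (simp add: Dpp_def partial_expH partial_expd expdd_def pidx_def matrix_vector_mult_def inner_vec_def sum_2 axis_def power2_eq_square algebra_simps)
  moreover have "exp (x$3) * (v$1)^2 + 2 * (v$2)^2 > 0" if "v \<noteq> 0" for v :: "real^2"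
  proof (cases "v$1 = 0")
    case True then have "v$2 \<noteq> 0" using that by (simp add: vec_eq_iff forall_2)
    then show ?thesis using True by simp
  next
    case False then show ?thesis by (simp add: add_pos_nonneg)
  qed
  ultimately show ?thesis unfolding positive_definite_def by simp
qed

lemma fibre_expH: "fibre expH b p = exp p + (b$2)^2"
  by (simp add: fibre_def expH_def vector_def numeral_eq_Suc)

lemma deriv_fibre_expH: "deriv (fibre expH b) p = exp p"
  by (rule DERIV_imp_deriv) (auto simp: fibre_expH[abs_def] intro!: derivative_eq_intros)

lemma exp_gt_tangent: "1 + u < exp u" if "u \<noteq> 0" for u :: real
proof (cases "1 + u / 2 \<ge> 0")
  case True
  have "1 + u < (1 + u / 2)^2" using that zero_less_power2[of u]
    by (auto simp: power2_eq_square algebra_simps)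
  also have "\<dots> \<le> exp (u / 2) ^ 2" using True by (intro power_mono exp_ge_add_one_self) auto
  also have "\<dots> = exp u" by (simp add: power2_eq_square flip: exp_add)
  finally show ?thesis .
next
  case False
  then have "1 + u < 0" by simp
  then show ?thesis using exp_gt_zero[of u] by linarith
qed

lemma strictly_convex_fibre_expH: "strictly_convex (fibre expH b)"
  unfolding strictly_convex_def
proof (intro allI impI, elim conjE)
  fix p q t :: real assume a: "p \<noteq> q" "0 < t" "t < 1"
  define z where "z = t * p + (1 - t) * q"
  have "p - z = (1 - t) * (p - q)" "q - z = - t * (p - q)"
    by (simp_all add: z_def algebra_simps)
  then have "p - z \<noteq> 0" "q - z \<noteq> 0" using a by simp_all
  then have "1 + (p - z) < exp (p - z)" "1 + (q - z) < exp (q - z)"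
    by (simp_all only: exp_gt_tangent not_False_eq_True)
  then have "t * (1 + (p - z)) + (1 - t) * (1 + (q - z)) < t * exp (p - z) + (1 - t) * exp (q - z)"
    using a by (intro add_strict_mono mult_strict_left_mono) auto
  also have "t * (1 + (p - z)) + (1 - t) * (1 + (q - z)) = 1"
    by (simp add: z_def algebra_simps)
  finally have "exp z < exp z * (t * exp (p - z) + (1 - t) * exp (q - z))" by simp
  also have "\<dots> = t * exp p + (1 - t) * exp q" by (simp add: exp_diff field_simps)
  finally show "fibre expH b (t * p + (1 - t) * q) < t * fibre expH b p + (1 - t) * fibre expH b q"
    by (simp add: fibre_expH z_def algebra_simps)
qed

lemma convexity_not_imp_cond_U:
  "\<exists>H. C2_fun H \<and> (\<forall>x. positive_definite (Dpp H x)) \<and> (\<forall>b. strictly_convex (fibre H b)) \<and> \<not> cond_U H"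
proof -
  have "\<not> cond_U expH"
    unfolding cond_U_def deriv_fibre_expH 
    by (metis exp_gt_zero less_asym lt_ex)
  then show ?thesis
    using C2_expH positive_definite_Dpp_expH strictly_convex_fibre_expH by blast
qed

end

(* Under (C) each fibre function attains its minimum at some m, and convexity fixes the sign of
   h' on either side of m.  The counterexamples all have the form f (p_1) + g (p_2):
   exp p_1 + p_2^2 against (C), p_1^2 + p_2^2 + E against (R), p_1^4 against (N). *)

theory Submission
  imports Defs
begin

section \<open>Regularity of the fibre functions\<close>

lemma vector_4:
  fixes w x y z :: "'a::zero"
  shows "vector [w, x, y, z] $ (1::4) = w" "vector [w, x, y, z] $ (2::4) = x"
    "vector [w, x, y, z] $ (3::4) = y" "vector [w, x, y, z] $ (4::4) = z"
  by (simp_all add: vector_def numeral_eq_Suc)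

text \<open>Moving from a fibre point along \<open>axis 3 1\<close> stays in the fibre, so the
  partial derivative is the derivative of the fibre function shifted by p. The hypothesis concerns
  this direction alone, so the lemma applies to \<open>partial 3 H\<close> as well as to H.\<close>

lemma fibre_DERIV:
  assumes "\<And>x. (\<lambda>t. H (x + t *\<^sub>R axis 3 1)) differentiable (at 0)"
  shows "(fibre H b has_real_derivative partial 3 H (vector [0, b $ 1, p, b $ 2])) (at p)"
proof -
  let ?x = "vector [0, b $ 1, p, b $ 2] :: real^4"
  have line: "H (?x + t *\<^sub>R axis 3 1) = fibre H b (p + t)" for t
    by (auto simp: fibre_def vec_eq_iff forall_4 vector_4 axis_def intro!: arg_cong[of _ _ H])
  have "((\<lambda>t. H (?x + t *\<^sub>R axis 3 1)) has_real_derivative partial 3 H ?x) (at 0)"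
    unfolding partial_def using assms[of ?x] by (simp add: DERIV_deriv_iff_real_differentiable)
  then have "((\<lambda>t. fibre H b (t + p)) has_real_derivative partial 3 H ?x) (at 0)"
    by (simp only: line add.commute[of p])
  then show ?thesis using DERIV_shift[of "fibre H b" _ 0 p] by simp
qed

lemma continuous_on_fibre_point:
  fixes b :: "real^2"
  shows "continuous_on UNIV (\<lambda>p. vector [0, b $ 1, p, b $ 2] :: real^4)"
proof -
  \<comment> \<open>Rewriting the point as an affine function of p makes its continuity
    immediate.\<close>
  have "(\<lambda>p. vector [0, b $ 1, p, b $ 2] :: real^4) = (\<lambda>p. vector [0, b $ 1, 0, b $ 2] + p *\<^sub>R axis 3 1)"
    by (auto simp: fun_eq_iff vec_eq_iff forall_4 vector_4 axis_def)
  then show ?thesis by (simp only:) (intro continuous_intros)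
qed

lemma fibre_C1:
  assumes "C1_fun H"
  shows "fibre H b C1_differentiable_on UNIV"
proof -
  have "continuous_on UNIV (\<lambda>p. partial 3 H (vector [0, b $ 1, p, b $ 2]))"
    by (rule continuous_on_compose2[OF _ continuous_on_fibre_point]) (use assms in \<open>auto simp: C1_fun_def\<close>)
  then show ?thesis
    unfolding C1_differentiable_on_def
    using fibre_DERIV[of H b] assms
    by (intro exI[of _ "\<lambda>p. partial 3 H (vector [0, b $ 1, p, b $ 2])"])
       (auto simp: C1_fun_def has_real_derivative_iff_has_vector_derivative)
qed

section \<open>Minimisers on the fibres and condition (U)\<close>

lemma continuous_coercive_attains_min:
  fixes h :: "real \<Rightarrow> real"
  assumes "continuous_on UNIV h" and "\<And>M. \<exists>R. \<forall>p. \<bar>p\<bar> \<ge> R \<longrightarrow> h p \<ge> M"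
  shows "\<exists>m. \<forall>p. h m \<le> h p"
proof -
  obtain R where R: "\<And>p. \<bar>p\<bar> \<ge> R \<Longrightarrow> h p \<ge> h 0" using assms(2) by blast
  \<comment> \<open>The threshold \<open>h 0\<close> is beaten nowhere outside the ball. Since R may
    be negative, the radius is its absolute value, which keeps 0 inside, so that
    \<open>h m \<le> h 0\<close>.\<close>
  have "\<exists>m\<in>cball 0 \<bar>R\<bar>. \<forall>p\<in>cball 0 \<bar>R\<bar>. h m \<le> h p"
    using assms(1) by (intro continuous_attains_inf) (auto intro: continuous_on_subset)
  then obtain m where "\<forall>p\<in>cball 0 \<bar>R\<bar>. h m \<le> h p" by blast
  then have m: "\<bar>p\<bar> \<le> \<bar>R\<bar> \<Longrightarrow> h m \<le> h p" for p by simp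
  have "h m \<le> h p" for p
  proof (cases "\<bar>p\<bar> \<le> \<bar>R\<bar>")
    case False
    then have "h 0 \<le> h p" by (intro R) auto
    with m[of 0] show ?thesis by simp
  qed (rule m)
  then show ?thesis by blast
qed

lemma cond_C_fibre_attains_min:
  assumes "C1_fun H" "cond_C H"
  shows "\<exists>m. \<forall>p. fibre H b m \<le> fibre H b p"
proof (rule continuous_coercive_attains_min)
  show "continuous_on UNIV (fibre H b)"
    using fibre_C1[OF assms(1)] by (rule C1_differentiable_imp_continuous_on)
  show "\<exists>R. \<forall>p. \<bar>p\<bar> \<ge> R \<longrightarrow> fibre H b p \<ge> M" for M
    using assms(2) unfolding cond_C_def by meson
qed

text \<open>Uniqueness of m comes for free: strictly between two candidates the derivative would be
  both positive and negative.\<close>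

lemma cond_U_I:
  assumes "C1_fun H"
    and "\<And>b. \<exists>m. (\<forall>p<m. deriv (fibre H b) p < 0) \<and> (\<forall>p>m. deriv (fibre H b) p > 0)"
  shows "cond_U H"
  unfolding cond_U_def
proof (intro allI conjI fibre_C1[OF assms(1)] ex_ex1I assms(2))
  fix b m n
  let ?s = "\<lambda>m. (\<forall>p<m. deriv (fibre H b) p < 0) \<and> (\<forall>p>m. deriv (fibre H b) p > 0)"
  have le: "u \<ge> v" if "?s u" "?s v" for u v
  proof (rule ccontr)
    assume "\<not> u \<ge> v"
    then obtain w where "u < w" "w < v" using dense by (meson not_le)
    with that show False by (meson less_asym)
  qed
  show "m = n" if "?s m" "?s n"
    using le[OF that] le[OF that(2,1)] by (rule antisym[rotated])
qed

text \<open>Convexity bounds the slope at p in the direction of m by \<open>h m - h p\<close>, which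
  is negative because strict convexity excludes a second minimiser. The product form treats both
  sides of m at once.\<close>

lemma strictly_convex_min_deriv_sign:
  assumes "strictly_convex h" "(h has_real_derivative D) (at p)" "\<And>q. h m \<le> h q" "p \<noteq> m"
  shows "D * (p - m) > 0"
proof -
  \<comment> \<open>If \<open>h p\<close> equalled \<open>h m\<close>, the midpoint would lie below
    the minimum.\<close>
  have "h (1/2 * p + (1 - 1/2) * m) < 1/2 * h p + (1 - 1/2) * h m"
    by (rule assms(1)[unfolded strictly_convex_def, rule_format]) (use assms(4) in auto)
  with assms(3)[of "1/2 * p + (1 - 1/2) * m"] have lt: "h m < h p" by simp
  have "((\<lambda>t. h (p + t * (m - p))) has_real_derivative D * (m - p)) (at 0)"
    by (rule DERIV_chain2[of h D]) (auto intro!: derivative_eq_intros assms(2))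
  \<comment> \<open>A one-sided limit suffices: the convexity estimate is available for t between 0
    and 1 only.\<close>
  then have "((\<lambda>t. (h (p + t * (m - p)) - h p) / t) \<longlongrightarrow> D * (m - p)) (at_right 0)"
    by (simp add: DERIV_def filterlim_at_split)
  moreover have "\<forall>\<^sub>F t in at_right 0. (h (p + t * (m - p)) - h p) / t \<le> h m - h p"
    unfolding eventually_at_right_field
  proof (intro exI[of _ 1] conjI allI impI)
    fix t :: real assume t: "0 < t" "t < 1"
    have "h (t * m + (1 - t) * p) < t * h m + (1 - t) * h p"
      using assms(1,4) t unfolding strictly_convex_def by metis
    moreover have "t * m + (1 - t) * p = p + t * (m - p)" by (simp add: algebra_simps)
    ultimately have "h (p + t * (m - p)) < t * h m + (1 - t) * h p" by simp
    then show "(h (p + t * (m - p)) - h p) / t \<le> h m - h p"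
      using t by (simp add: field_simps)
  qed simp
  ultimately have "D * (m - p) \<le> h m - h p"
    by (intro tendsto_upperbound) auto
  with lt show ?thesis by (simp add: algebra_simps)
qed

lemma strictly_convex_imp_cond_U:
  assumes "C1_fun H" "\<And>b. strictly_convex (fibre H b)" "cond_C H"
  shows "cond_U H"
proof (rule cond_U_I[OF assms(1)])
  fix b
  obtain m where m: "\<And>q. fibre H b m \<le> fibre H b q"
    using cond_C_fibre_attains_min[OF assms(1,3)] by blast
  have "(fibre H b has_real_derivative deriv (fibre H b) p) (at p)" for p
    using fibre_DERIV[of H b p] assms(1) unfolding C1_fun_def by (metis DERIV_imp_deriv)
  then have sign: "p \<noteq> m \<Longrightarrow> deriv (fibre H b) p * (p - m) > 0" for p
    by (rule strictly_convex_min_deriv_sign[OF assms(2) _ m])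
  then show "\<exists>m. (\<forall>p<m. deriv (fibre H b) p < 0) \<and> (\<forall>p>m. deriv (fibre H b) p > 0)"
    by (intro exI[of _ m]) (force simp: zero_less_mult_iff dest: sign)
qed

text \<open>The fibre derivative is strictly increasing and vanishes at the minimiser supplied by
  \<open>cond_C\<close>, so it changes sign exactly there.\<close>

lemma positive_second_deriv_imp_cond_U:
  assumes "C2_fun H" "\<And>x. partial 3 (partial 3 H) x > 0" "cond_C H"
  shows "cond_U H"
proof (rule cond_U_I)
  show C1: "C1_fun H" using assms(1) by (simp add: C2_fun_def)
  fix b :: "real^2"
  let ?x = "\<lambda>p. vector [0, b $ 1, p, b $ 2] :: real^4"
  have D1: "(fibre H b has_real_derivative partial 3 H (?x p)) (at p)" for p
    using C1 by (intro fibre_DERIV) (simp add: C1_fun_def)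
  \<comment> \<open>The fibre of \<open>partial 3 H\<close> is the derivative of the fibre of H, so
    this is the second derivative.\<close>
  have D2: "(fibre (partial 3 H) b has_real_derivative partial 3 (partial 3 H) (?x p)) (at p)" for p
    using assms(1) by (intro fibre_DERIV) (simp add: C2_fun_def C1_fun_def)
  have mono: "partial 3 H (?x p) < partial 3 H (?x q)" if "p < q" for p q
    using DERIV_pos_imp_increasing[OF that, of "fibre (partial 3 H) b"] D2 assms(2)
    by (fastforce simp: fibre_def)
  obtain m where m: "\<And>q. fibre H b m \<le> fibre H b q"
    using cond_C_fibre_attains_min[OF C1 assms(3)] by blast
  have "partial 3 H (?x m) = 0"
    using DERIV_local_min[OF D1, of 1 m] m by simp
  then show "\<exists>m. (\<forall>p<m. deriv (fibre H b) p < 0) \<and> (\<forall>p>m. deriv (fibre H b) p > 0)"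
    using mono DERIV_imp_deriv[OF D1] by (metis (no_types, lifting))
qed

text \<open>Evaluating the quadratic form at the first basis vector picks out the upper left
  entry.\<close>

lemma positive_definite_Dpp_imp_pos:
  assumes "positive_definite (Dpp H x)"
  shows "partial 3 (partial 3 H) x > 0"
proof -
  have "axis 1 1 \<bullet> (Dpp H x *v axis 1 1) > 0"
    using assms unfolding positive_definite_def by (simp add: axis_eq_0_iff)
  then show ?thesis
    by (simp add: inner_axis' matrix_vector_mul_component Dpp_def pidx_def inner_axis)
qed

section \<open>Separable Hamiltonians in the two momenta\<close>

lemma vec_nth_chain:
  fixes F :: "real \<Rightarrow> real"
  assumes "(F has_real_derivative D) (at (x $ k))"
  shows "((\<lambda>x :: real^'n. F (x $ k)) has_derivative (\<lambda>v. D * v $ k)) (at x)"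
  using has_derivative_compose[OF bounded_linear_imp_has_derivative[OF bounded_linear_vec_nth[of k]]
      assms[unfolded has_field_derivative_def]] .

lemma separable_has_derivative:
  fixes f g :: "real \<Rightarrow> real"
  assumes "\<And>p. (f has_real_derivative f' p) (at p)" "\<And>p. (g has_real_derivative g' p) (at p)"
  shows "((\<lambda>x :: real^4. f (x$3) + g (x$4)) has_derivative (\<lambda>v. f' (x$3) * v$3 + g' (x$4) * v$4)) (at x)"
  by (intro has_derivative_add vec_nth_chain assms)

lemma partial_separable:
  fixes f g :: "real \<Rightarrow> real"
  assumes "\<And>p. (f has_real_derivative f' p) (at p)" "\<And>p. (g has_real_derivative g' p) (at p)"
  shows "partial i (\<lambda>x :: real^4. f (x$3) + g (x$4)) =
    (\<lambda>x. f' (x$3) * axis i 1 $ 3 + g' (x$4) * axis i 1 $ 4)"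
  using partial_of_derivative(2)[OF separable_has_derivative[OF assms]] by (rule ext)

lemma C1_separable:
  fixes f g :: "real \<Rightarrow> real"
  assumes D: "\<And>p. (f has_real_derivative f' p) (at p)" "\<And>p. (g has_real_derivative g' p) (at p)"
    and c: "continuous_on UNIV f'" "continuous_on UNIV g'"
  shows "C1_fun (\<lambda>x :: real^4. f (x$3) + g (x$4))"
  unfolding C1_fun_def partial_separable[OF D]
  using partial_of_derivative(1)[OF separable_has_derivative[OF D]]
  by (auto intro!: continuous_intros continuous_on_compose2[OF c(1)] continuous_on_compose2[OF c(2)])

text \<open>Reduces each counterexample built from it to one-variable derivative checks for f and
  g.\<close>

locale separable_hamiltonian =
  fixes f f' f'' g g' g'' :: "real \<Rightarrow> real"
  assumes f: "\<And>p. (f has_real_derivative f' p) (at p)" "\<And>p. (f' has_real_derivative f'' p) (at p)"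
      "continuous_on UNIV f''"
    and g: "\<And>p. (g has_real_derivative g' p) (at p)" "\<And>p. (g' has_real_derivative g'' p) (at p)"
      "continuous_on UNIV g''"
begin

definition ham :: "real^4 \<Rightarrow> real" where "ham x = f (x$3) + g (x$4)"

lemma ham_partial: "partial i ham = (\<lambda>x. f' (x$3) * axis i 1 $ 3 + g' (x$4) * axis i 1 $ 4)"
  unfolding ham_def[abs_def] by (rule partial_separable[OF f(1) g(1)])

lemma ham_partial2: "partial j (partial i ham) =
    (\<lambda>x. f'' (x$3) * axis i 1 $ 3 * axis j 1 $ 3 + g'' (x$4) * axis i 1 $ 4 * axis j 1 $ 4)"
  unfolding ham_partial
  \<comment> \<open>A first partial is again separable, with \<open>f'\<close> and \<open>g'\<close>
    scaled by the constant components of \<open>axis i 1\<close>.\<close>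
  by (rule partial_separable; rule DERIV_cmult_right; rule f(2) g(2))

lemma C2_ham: "C2_fun ham"
proof -
  have cf: "continuous_on UNIV f'" "continuous_on UNIV g'"
    by (rule DERIV_continuous_on[OF has_field_derivative_at_within], rule f(2) g(2))+
  have "C1_fun (partial i ham)" for i
    unfolding ham_partial
    by (rule C1_separable[OF DERIV_cmult_right[OF f(2)] DERIV_cmult_right[OF g(2)]])
       (intro continuous_on_mult_right f(3) g(3))+
  moreover have "C1_fun ham"
    unfolding ham_def[abs_def] by (rule C1_separable[OF f(1) g(1) cf])
  ultimately show ?thesis unfolding C2_fun_def by blast
qed

lemma fibre_ham: "fibre ham b p = f p + g (b $ 2)"
  by (simp add: fibre_def ham_def vector_4)

lemma positive_definite_Dpp_ham:
  assumes "\<And>p. f'' p > 0" "\<And>p. g'' p > 0"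
  shows "positive_definite (Dpp ham x)"
  unfolding positive_definite_def
proof (intro allI impI)
  fix v :: "real^2" assume "v \<noteq> 0"
  then have "v$1 \<noteq> 0 \<or> v$2 \<noteq> 0" by (auto simp: vec_eq_iff forall_2)
  then have "f'' (x$3) * (v$1)\<^sup>2 + g'' (x$4) * (v$2)\<^sup>2 > 0"
    using assms[of "x$3"] assms[of "x$4"]
    by (smt (verit) mult_nonneg_nonneg mult_pos_pos zero_le_power2 zero_less_power2)
  also have "f'' (x$3) * (v$1)\<^sup>2 + g'' (x$4) * (v$2)\<^sup>2 = v \<bullet> (Dpp ham x *v v)"
    by (simp add: Dpp_def ham_partial2 pidx_def matrix_vector_mult_def inner_vec_def sum_2 axis_def
        power2_eq_square algebra_simps)
  finally show "v \<bullet> (Dpp ham x *v v) > 0" .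
qed

text \<open>With g bounded below, the radius \<open>M + c - d\<close> does not depend on b, so the
  whole plane serves as the neighbourhood.\<close>

lemma cond_C_ham:
  assumes "\<And>p. f p \<ge> \<bar>p\<bar> - c" "\<And>p. g p \<ge> d"
  shows "cond_C ham"
  unfolding cond_C_def
proof (intro allI exI[of _ UNIV] conjI)
  show "\<exists>R. \<forall>b\<in>UNIV. \<forall>p. \<bar>p\<bar> \<ge> R \<longrightarrow> fibre ham b p \<ge> M" for M
  proof (intro exI[of _ "M + c - d"] ballI allI impI)
    fix b :: "real^2" and p assume "\<bar>p\<bar> \<ge> M + c - d"
    with assms(1)[of p] assms(2)[of "b$2"] show "fibre ham b p \<ge> M" unfolding fibre_ham by linarith
  qed
qed auto

end

section \<open>Failure of (C), (R) and (N)\<close>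

lemma not_cond_C_expH: "\<not> cond_C expH"
proof
  assume "cond_C expH"
  then obtain V R where "0 \<in> V" "\<And>b p. b \<in> V \<Longrightarrow> \<bar>p\<bar> \<ge> R \<Longrightarrow> fibre expH b p \<ge> 2"
    unfolding cond_C_def by meson
  \<comment> \<open>Far out on the negative side the exponential stays at most 1, below the level
    2.\<close>
  then have "fibre expH 0 (- \<bar>R\<bar>) \<ge> 2" by simp
  moreover have "exp (- \<bar>R\<bar>) \<le> 1" by simp
  ultimately show False unfolding fibre_expH by simp
qed

text \<open>The fourth power is the square of the square. Convexity of squaring is used twice,
  strictly for p and q and weakly for their squares.\<close>

lemma strictly_convex_power4: "strictly_convex (\<lambda>p. p ^ 4 + c)"
  unfolding strictly_convex_def
proof (intro allI impI, elim conjE)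
  fix p q t :: real assume a: "p \<noteq> q" "0 < t" "t < 1"
  \<comment> \<open>The variance of a two-point distribution, which measures the convexity gap of
    the square.\<close>
  have sq: "t * u\<^sup>2 + (1 - t) * v\<^sup>2 - (t * u + (1 - t) * v)\<^sup>2 = t * (1 - t) * (u - v)\<^sup>2" for u v :: real
    by (simp add: power2_eq_square algebra_simps)
  have "t * (1 - t) * (p - q)\<^sup>2 > 0" using a by simp
  then have "((t * p + (1 - t) * q)\<^sup>2)\<^sup>2 < (t * p\<^sup>2 + (1 - t) * q\<^sup>2)\<^sup>2"
    using sq[of p q] by (intro power_strict_mono) auto
  moreover have "t * (1 - t) * (p\<^sup>2 - q\<^sup>2)\<^sup>2 \<ge> 0" using a by simp
  ultimately have "((t * p + (1 - t) * q)\<^sup>2)\<^sup>2 < t * (p\<^sup>2)\<^sup>2 + (1 - t) * (q\<^sup>2)\<^sup>2"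
    using sq[of "p\<^sup>2" "q\<^sup>2"] by linarith
  then show "(t * p + (1 - t) * q) ^ 4 + c < t * (p ^ 4 + c) + (1 - t) * (q ^ 4 + c)"
    by (simp add: algebra_simps flip: power_mult)
qed

lemma abs_le_square_plus_1: "\<bar>p\<bar> - 1 \<le> (p :: real)\<^sup>2"
proof -
  have "0 \<le> (\<bar>p\<bar> - 1/2)\<^sup>2" by simp
  also have "\<dots> = p\<^sup>2 - \<bar>p\<bar> + 1/4" by (simp add: power2_diff power_divide)
  finally show ?thesis by simp
qed

text \<open>Apply the quadratic bound to p and to its square, losing 1 each time.\<close>

lemma abs_le_power4_plus_2: "\<bar>p\<bar> - 2 \<le> (p :: real) ^ 4"
proof -
  have "p ^ 4 = (p\<^sup>2)\<^sup>2" by (simp flip: power_mult)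
  then show ?thesis
    using abs_le_square_plus_1[of p] abs_le_square_plus_1[of "p\<^sup>2"] by simp
qed

text \<open>For \<open>p\<^sub>1\<^sup>2 + p\<^sub>2\<^sup>2 + E\<close> the fibrewise infimum \<open>p\<^sub>2\<^sup>2 + E\<close> has a critical point at level \<open>E\<close>.\<close>

lemma positive_definite_not_imp_cond_R:
  "\<exists>H. C2_fun H \<and> (\<forall>x. positive_definite (Dpp H x)) \<and> cond_C H \<and> \<not> cond_R H E"
proof -
  \<comment> \<open>The constant E in g moves the critical level to the prescribed energy.\<close>
  interpret separable_hamiltonian power2 "\<lambda>p. 2 * p" "\<lambda>_. 2" "\<lambda>p. p\<^sup>2 + E" "\<lambda>p. 2 * p" "\<lambda>_. 2"
    by unfold_locales (auto intro!: derivative_eq_intros)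
  have C: "cond_C ham"
    by (rule cond_C_ham[of 1 E]) (use abs_le_square_plus_1 in auto)
  have inf: "fibre_inf ham b = (b $ 2)\<^sup>2 + E" for b
    unfolding fibre_inf_def fibre_ham
    by (rule cInf_eq_minimum[of _ "range (\<lambda>p. p\<^sup>2 + ((b $ 2)\<^sup>2 + E))"]) auto
  have "\<not> cond_R ham E"
  proof
    assume "cond_R ham E"
    moreover have "fibre_inf ham 0 = E" by (simp add: inf)
    ultimately obtain D where D: "(fibre_inf ham has_derivative D) (at 0)" "surj D"
      unfolding cond_R_def regular_value_def by blast
    \<comment> \<open>The origin is a global minimum of \<open>fibre_inf ham\<close>, so the
      derivative there vanishes and cannot be onto.\<close>
    have "D v = 0" for v
      using differential_zero_maxmin[of 0 UNIV "fibre_inf ham" D] D(1)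
      by (simp add: inf)
    with D(2) show False by (metis surjD zero_neq_one)
  qed
  then show ?thesis
    using C2_ham C positive_definite_Dpp_ham by (intro exI[of _ ham]) auto
qed

lemma strictly_convex_not_imp_cond_N:
  "\<exists>H. C2_fun H \<and> (\<forall>b. strictly_convex (fibre H b)) \<and> cond_C H \<and> \<not> cond_N H"
proof -
  interpret separable_hamiltonian "\<lambda>p. p ^ 4" "\<lambda>p. 4 * p ^ 3" "\<lambda>p. 12 * p ^ 2" "\<lambda>_. 0" "\<lambda>_. 0" "\<lambda>_. 0"
    by unfold_locales (auto intro!: derivative_eq_intros continuous_intros)
  have C: "cond_C ham"
    by (rule cond_C_ham[of 2 0]) (use abs_le_power4_plus_2 in auto)
  have "strictly_convex (fibre ham b)" for b
    using strictly_convex_power4[of 0] by (simp add: fibre_ham[abs_def])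
  moreover have "\<not> cond_N ham"
    \<comment> \<open>The origin is fibrewise critical, and \<open>12 * p ^ 2\<close> vanishes
      there. Second partials are unfolded first, while the inner \<open>partial\<close> is still
      visible.\<close>
    unfolding cond_N_def fibre_critical_def ham_partial2 unfolding ham_partial
    by (auto intro!: exI[of _ 0])
  ultimately show ?thesis using C2_ham C by blast
qed

text \<open>The clauses deducing (U) assume \<open>cond_C\<close> because
  \<open>convexity_not_imp_cond_U\<close> refutes them otherwise. The failures of (R) and (N) are
  exhibited under \<open>cond_C\<close> too, so \<open>fibre_inf\<close> is a genuine infimum, and
  (R) can be made to fail at any prescribed E.\<close>

theorem proposition5p2:
  shows "(\<forall>H. C2_fun H \<and> (\<forall>x. positive_definite (Dpp H x)) \<longrightarrow>
             (\<forall>x. partial 3 (partial 3 H) x > 0) \<and> (cond_C H \<longrightarrow> cond_U H) \<and>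
             cond_N H \<and> cond_N_pos H) \<and>
         (\<exists>H. C2_fun H \<and> (\<forall>x. positive_definite (Dpp H x)) \<and> \<not> cond_C H) \<and>
         (\<forall>E. \<exists>H. C2_fun H \<and> (\<forall>x. positive_definite (Dpp H x)) \<and> cond_C H \<and> \<not> cond_R H E) \<and>
         (\<forall>H. C2_fun H \<and> (\<forall>b. strictly_convex (fibre H b)) \<and> cond_C H \<longrightarrow> cond_U H) \<and>
         (\<exists>H. C2_fun H \<and> (\<forall>b. strictly_convex (fibre H b)) \<and> cond_C H \<and> \<not> cond_N H)"
proof (intro conjI allI)
  fix H :: "real^4 \<Rightarrow> real"
  show "C2_fun H \<and> (\<forall>x. positive_definite (Dpp H x)) \<longrightarrow>
             (\<forall>x. partial 3 (partial 3 H) x > 0) \<and> (cond_C H \<longrightarrow> cond_U H) \<and>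
             cond_N H \<and> cond_N_pos H"
  proof (intro impI, elim conjE)
    assume "C2_fun H" and pd: "\<forall>x. positive_definite (Dpp H x)"
    have pos: "partial 3 (partial 3 H) x > 0" for x
      using pd positive_definite_Dpp_imp_pos by blast
    have "cond_N H" "cond_N_pos H"
      unfolding cond_N_def cond_N_pos_def using pos by (metis less_irrefl, blast)
    then show "(\<forall>x. partial 3 (partial 3 H) x > 0) \<and> (cond_C H \<longrightarrow> cond_U H) \<and> cond_N H \<and> cond_N_pos H"
      using pos positive_second_deriv_imp_cond_U[OF \<open>C2_fun H\<close> pos] by blast
  qed
next
  show "\<exists>H. C2_fun H \<and> (\<forall>x. positive_definite (Dpp H x)) \<and> \<not> cond_C H"
    using C2_expH positive_definite_Dpp_expH not_cond_C_expH by blast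
next
  show "\<exists>H. C2_fun H \<and> (\<forall>x. positive_definite (Dpp H x)) \<and> cond_C H \<and> \<not> cond_R H E" for E
    by (rule positive_definite_not_imp_cond_R)
next
  show "C2_fun H \<and> (\<forall>b. strictly_convex (fibre H b)) \<and> cond_C H \<longrightarrow> cond_U H" for H
    using strictly_convex_imp_cond_U by (simp add: C2_fun_def)
next
  show "\<exists>H. C2_fun H \<and> (\<forall>b. strictly_convex (fibre H b)) \<and> cond_C H \<and> \<not> cond_N H"
    by (rule strictly_convex_not_imp_cond_N)
qed

end
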